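(* Let $F$ be a (finite) confluence. A subset $C$ of $F$ is a closure subset of $F$ if and only if $C$ is closed under local meet. In that case the closure operator $f : F \to F$ with $f[F]=C$ is given, for every $t\in F$, by $$f(t) = {\bigwedge}_t \{\, c \mid c \in C \cap F^t \,\},$$ where ${\bigwedge}_t$ denotes the meet taken in the lattice $F^t$.
   Context: All ordered sets are finite. For an ordered set $E$ and $t\in E$, $E^t=\{x\in E : x\ge t\}$. A (finite) ordered set $F$ is a confluence if for every $t\in F$ the set $F^t$ (with the induced order) is a meet-semilattice with a greatest element $\top_t$; by finiteness, $F^t$ is then a lattice. Its meet is written $\wedge_t$ (local meet). A subset $S$ of $F^t$ is closed under $\wedge_t$ if the meet in $F^t$ of every subset of $S$, including the empty subset (whose meet is $\top_t$), belongs to $S$. A subset $C\subseteq F$ is closed under local meet if for every $t\in F$ the set $C\cap F^t$ is closed under $\wedge_t$. A closure operator on an ordered set $E$ is a map $f:E\to E$ that is monotone, idempotent and extensive ($f(x)\ge x$). A subset $C\subseteq E$ is a closure subset if there is a closure operator $f$ on $E$ with $C=f[E]$. *)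

theory Defs
  imports "HOL-Algebra.Lattice"
begin

definition principal_filter :: "('a, 'b) gorder_scheme \<Rightarrow> 'a \<Rightarrow> ('a, 'b) gorder_scheme"
  where "principal_filter F t = F\<lparr>carrier := {x \<in> carrier F. t \<sqsubseteq>\<^bsub>F\<^esub> x}\<rparr>"

locale confluence = partial_order F for F (structure) +
  assumes finite_carrier: "finite (carrier F)"
    and filter_semilattice: "t \<in> carrier F \<Longrightarrow> lower_semilattice (principal_filter F t)"
    and filter_top: "t \<in> carrier F \<Longrightarrow>
      \<exists>g. greatest (principal_filter F t) g (carrier (principal_filter F t))"

text \<open>
  The case \<open>A = {}\<close> is included: \<open>Lower L {} = carrier L\<close>, so the meet of the empty
  subset is the greatest element of \<open>L\<close>.
\<close>
definition closed_under_meets :: "('a, 'b) gorder_scheme \<Rightarrow> 'a set \<Rightarrow> bool"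
  where "closed_under_meets L S \<longleftrightarrow> S \<subseteq> carrier L \<and> (\<forall>A \<subseteq> S. \<Sqinter>\<^bsub>L\<^esub>A \<in> S)"

definition closed_under_local_meet :: "('a, 'b) gorder_scheme \<Rightarrow> 'a set \<Rightarrow> bool"
  where "closed_under_local_meet F C \<longleftrightarrow> C \<subseteq> carrier F \<and>
    (\<forall>t \<in> carrier F.
      closed_under_meets (principal_filter F t) (C \<inter> carrier (principal_filter F t)))"

definition closure_operator :: "('a, 'b) gorder_scheme \<Rightarrow> ('a \<Rightarrow> 'a) \<Rightarrow> bool"
  where "closure_operator E f \<longleftrightarrow> f \<in> carrier E \<rightarrow> carrier E \<and>
    isotone E E f \<and> idempotent E f \<and> (\<forall>x \<in> carrier E. x \<sqsubseteq>\<^bsub>E\<^esub> f x)"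

definition closure_subset :: "('a, 'b) gorder_scheme \<Rightarrow> 'a set \<Rightarrow> bool"
  where "closure_subset E C \<longleftrightarrow> C \<subseteq> carrier E \<and> (\<exists>f. closure_operator E f \<and> f ` carrier E = C)"

end

(*
  Both directions rest on one fact: C is a closure subset exactly when every t has a least
  element of C above it, and the closure of t is that element. If f is a closure operator with
  image C and m is the local meet of a set A of fixed points above t, then f m is again a lower
  bound of A above t, so f m = m. Conversely, closure under local meet puts the meet of all
  elements of C above t into C, which makes it the least such element.
*)
theory Submission
  imports Defs
begin

lemma carrier_principal_filter [simp]:
  "carrier (principal_filter F t) = {x \<in> carrier F. t \<sqsubseteq>\<^bsub>F\<^esub> x}"
  by (simp add: principal_filter_def)

lemma le_principal_filter [simp]: "le (principal_filter F t) = le F"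
  by (simp add: principal_filter_def)

context confluence
begin

text \<open>Binary meets yield the meet of every nonempty finite set. For the empty set every
  element of the filter is a lower bound, so there the top element takes over. Once a greatest lower
  bound exists, the choice operator behind \<open>inf\<close> returns one.\<close>

lemma local_meet_greatest:
  assumes t: "t \<in> carrier F" and A: "A \<subseteq> carrier (principal_filter F t)"
  shows "greatest (principal_filter F t) (\<Sqinter>\<^bsub>principal_filter F t\<^esub>A)
    (Lower (principal_filter F t) A)"
proof (cases "A = {}")
  case True
  then show ?thesis
    using filter_top[OF t] unfolding inf_def by (metis Lower_empty someI_ex)
next
  case False
  interpret L: lower_semilattice "principal_filter F t"
    by (rule filter_semilattice[OF t])
  have "finite A"
    using A finite_carrier by (auto intro: finite_subset)
  then show ?thesis
    using L.finite_inf_greatest A False by blast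
qed

text \<open>These restate the greatest lower bound property in the order of \<open>F\<close>, so
  that later arguments need not work inside the filter.\<close>

lemma
  assumes t: "t \<in> carrier F" and A: "A \<subseteq> carrier (principal_filter F t)"
  shows local_meet_closed: "\<Sqinter>\<^bsub>principal_filter F t\<^esub>A \<in> carrier F"
    and local_meet_above: "t \<sqsubseteq> \<Sqinter>\<^bsub>principal_filter F t\<^esub>A"
    and local_meet_le: "a \<in> A \<Longrightarrow> \<Sqinter>\<^bsub>principal_filter F t\<^esub>A \<sqsubseteq> a"
    and local_meet_ge: "\<lbrakk>x \<in> carrier F; t \<sqsubseteq> x; \<And>a. a \<in> A \<Longrightarrow> x \<sqsubseteq> a\<rbrakk>
      \<Longrightarrow> x \<sqsubseteq> \<Sqinter>\<^bsub>principal_filter F t\<^esub>A"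
  using local_meet_greatest[OF assms] A by (auto simp: greatest_def Lower_def)

lemma closure_operator_fixes_image:
  assumes "closure_operator F f" and "c \<in> f ` carrier F"
  shows "f c = c"
  using assms by (auto simp: closure_operator_def idempotent_def eq_is_equal)

text \<open>The meet is a minimum: \<open>f t\<close> belongs to the set, and any fixed point
  \<open>c\<close> above \<open>t\<close> satisfies
  \<open>f t \<sqsubseteq> f c = c\<close>.\<close>

lemma closure_operator_eq_local_meet:
  assumes f: "closure_operator F f" and t: "t \<in> carrier F"
  shows "f t = \<Sqinter>\<^bsub>principal_filter F t\<^esub>
    (f ` carrier F \<inter> carrier (principal_filter F t))" (is "_ = \<Sqinter>\<^bsub>_\<^esub>?A")
proof (rule le_antisym)
  have ft: "f t \<in> carrier F" "t \<sqsubseteq> f t"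
    using f t by (auto simp: closure_operator_def)
  show "f t \<sqsubseteq> \<Sqinter>\<^bsub>principal_filter F t\<^esub>?A"
  proof (rule local_meet_ge[OF t _ ft])
    fix c assume "c \<in> ?A"
    then have c: "c \<in> f ` carrier F" "c \<in> carrier F" "t \<sqsubseteq> c" by auto
    then have "f t \<sqsubseteq> f c"
      using f t by (auto simp: closure_operator_def isotone_def)
    then show "f t \<sqsubseteq> c"
      using closure_operator_fixes_image[OF f c(1)] by simp
  qed simp
  show "\<Sqinter>\<^bsub>principal_filter F t\<^esub>?A \<sqsubseteq> f t"
    using ft t by (intro local_meet_le) auto
  show "f t \<in> carrier F" by (rule ft)
  show "\<Sqinter>\<^bsub>principal_filter F t\<^esub>?A \<in> carrier F"
    using t by (intro local_meet_closed) auto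
qed

lemma closure_operator_image_closed_under_local_meet:
  assumes f: "closure_operator F f"
  shows "closed_under_local_meet F (f ` carrier F)"
proof -
  have maps: "f x \<in> carrier F" and ext: "x \<sqsubseteq> f x" if "x \<in> carrier F" for x
    using f that by (auto simp: closure_operator_def)
  have "\<Sqinter>\<^bsub>principal_filter F t\<^esub>A \<in> f ` carrier F \<inter> carrier (principal_filter F t)"
    if t: "t \<in> carrier F" and A: "A \<subseteq> f ` carrier F \<inter> carrier (principal_filter F t)" for t A
  proof -
    let ?m = "\<Sqinter>\<^bsub>principal_filter F t\<^esub>A"
    have A': "A \<subseteq> carrier (principal_filter F t)" using A by blast
    have m: "?m \<in> carrier F" and tm: "t \<sqsubseteq> ?m"
      using local_meet_closed[OF t A'] local_meet_above[OF t A'] by auto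
    \<comment> \<open>Extensivity gives the converse inequality. The case of empty \<open>A\<close>
      needs no separate treatment: \<open>?m\<close> is then the top of the filter and the bound
      over \<open>A\<close> is vacuous.\<close>
    have "f ?m \<sqsubseteq> ?m"
    proof (rule local_meet_ge[OF t A' maps[OF m]])
      \<comment> \<open>A local meet dominates only those lower bounds that lie in the filter of
        \<open>t\<close>.\<close>
      show "t \<sqsubseteq> f ?m" using le_trans[OF tm ext[OF m] t m maps[OF m]] .
      fix a assume a: "a \<in> A"
      then have "a \<in> f ` carrier F" and "a \<in> carrier F"
        using A by auto
      then have fa: "f a = a"
        using closure_operator_fixes_image[OF f] by blast
      have "?m \<sqsubseteq> a" using local_meet_le[OF t A' a] .
      then have "f ?m \<sqsubseteq> f a"
        using f m \<open>a \<in> carrier F\<close> by (auto simp: closure_operator_def isotone_def)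
      then show "f ?m \<sqsubseteq> a" using fa by simp
    qed
    then have "f ?m = ?m" using ext m maps by (intro le_antisym) auto
    then have "?m \<in> f ` carrier F" using m by (metis imageI)
    then show ?thesis using m tm by simp
  qed
  moreover have "f ` carrier F \<subseteq> carrier F"
    using maps by blast
  ultimately show ?thesis
    unfolding closed_under_local_meet_def closed_under_meets_def
    by (intro conjI ballI allI impI Int_lower2)
qed

lemma closed_under_local_meet_imp_closure_subset:
  assumes "closed_under_local_meet F C"
  shows "closure_subset F C"
proof -
  define f where "f t = \<Sqinter>\<^bsub>principal_filter F t\<^esub>(C \<inter> carrier (principal_filter F t))" for t
  have C: "C \<subseteq> carrier F"
    using assms by (simp add: closed_under_local_meet_def)
  have f_in: "f t \<in> C" if "t \<in> carrier F" for t
    using assms that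
    unfolding closed_under_local_meet_def closed_under_meets_def f_def by blast
  have ext: "t \<sqsubseteq> f t" if "t \<in> carrier F" for t
    unfolding f_def using that by (intro local_meet_above) auto
  have least: "f t \<sqsubseteq> c" if "t \<in> carrier F" "c \<in> C" "t \<sqsubseteq> c" for t c
    unfolding f_def using that C by (intro local_meet_le) auto
  \<comment> \<open>An element of \<open>C\<close> is itself the least element of \<open>C\<close>
    above it.\<close>
  have fixes_C: "f c = c" if "c \<in> C" for c
    using that C by (meson le_antisym least ext f_in le_refl subsetD)
  \<comment> \<open>\<open>f t\<close> is an element of \<open>C\<close> above \<open>s\<close>, so
    \<open>least\<close> applies to it.\<close>
  have "f s \<sqsubseteq> f t" if "s \<in> carrier F" "t \<in> carrier F" "s \<sqsubseteq> t" for s t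
    using that C f_in ext by (meson least le_trans subsetD)
  \<comment> \<open>\<open>isotone\<close> includes the order axioms of its domain and
    codomain.\<close>
  moreover have "weak_partial_order F" ..
  ultimately have "closure_operator F f"
    using C f_in ext fixes_C
    by (auto simp: closure_operator_def isotone_def idempotent_def eq_is_equal)
  moreover have "f ` carrier F = C"
  proof
    show "f ` carrier F \<subseteq> C" using f_in by blast
    show "C \<subseteq> f ` carrier F" using C fixes_C by (metis imageI subsetD subsetI)
  qed
  ultimately show ?thesis
    using C by (auto simp: closure_subset_def)
qed

end

theorem theorem1:
  fixes F :: "('a, 'b) gorder_scheme" and C :: "'a set"
  assumes "confluence F"
    and "C \<subseteq> carrier F"
  shows "(closure_subset F C \<longleftrightarrow> closed_under_local_meet F C) \<and>
    (closure_subset F C \<longrightarrow>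
      (\<forall>f. closure_operator F f \<and> f ` carrier F = C \<longrightarrow>
        (\<forall>t \<in> carrier F.
          f t = \<Sqinter>\<^bsub>principal_filter F t\<^esub>(C \<inter> carrier (principal_filter F t)))))"
proof -
  interpret confluence F by (rule assms(1))
  show ?thesis
  proof (intro conjI iffI impI allI ballI)
    show "closed_under_local_meet F C" if "closure_subset F C"
      using that closure_operator_image_closed_under_local_meet
      by (auto simp: closure_subset_def)
    show "closure_subset F C" if "closed_under_local_meet F C"
      using that by (rule closed_under_local_meet_imp_closure_subset)
    show "f t = \<Sqinter>\<^bsub>principal_filter F t\<^esub>(C \<inter> carrier (principal_filter F t))"
      if "closure_operator F f \<and> f ` carrier F = C" "t \<in> carrier F" for f t
      using that closure_operator_eq_local_meet by blast
  qed
qed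

end
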